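(* Let $1<\alpha<2$, let $a,b\in\mathbb{R}$ be such that $b-a$ is an integer with $b-a\ge 2$, and let $q:\mathbb{N}^{b}_{a+2}\to\mathbb{R}$. If the discrete fractional boundary value problem $$\begin{cases}(\nabla^{\alpha}_{a}u)(t)+q(t)u(t)=0,\quad t\in\mathbb{N}^{b}_{a+2},\\ (\nabla^{\alpha-1}_{a}u)(a+1)=0,\quad u(b)=0,\end{cases}$$ has a nontrivial solution $u:\mathbb{N}^{b}_{a+1}\to\mathbb{R}$ (i.e. a solution not identically zero), then $$\sum_{s=a+2}^{b}|q(s)|\ \ge\ \frac{\alpha-1}{b-a-1}.$$
   Context: For $a,b\in\mathbb{R}$ with $b-a\in\mathbb{Z}$: $\mathbb{N}_a=\{a,a+1,a+2,\dots\}$ and $\mathbb{N}_a^b=\{a,a+1,\dots,b\}$ (empty if $b<a$). Empty sums are $0$. The generalized rising function is $t^{\overline{r}}=\Gamma(t+r)/\Gamma(t)$ for $t,t+r\in\mathbb{R}\setminus\{0,-1,-2,\dots\}$, and $0^{\overline r}:=0$. The nabla difference is $(\nabla u)(t)=u(t)-u(t-1)$, and $\nabla^N$ is its $N$-fold iterate. For $\nu>0$ the nabla fractional sum based at $a$ is $(\nabla_a^{-\nu}u)(t)=\frac{1}{\Gamma(\nu)}\sum_{s=a+1}^{t}(t-s+1)^{\overline{\nu-1}}u(s)$ (so $(\nabla_a^{-\nu}u)(a)=0$ as an empty sum), and $\nabla_a^{-0}u=u$. For $\nu>0$ and a positive integer $N$ with $N-1<\nu\le N$, the Riemann-Liouville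 nabla fractional difference is $(\nabla_a^{\nu}u)(t)=\big(\nabla^N(\nabla_a^{-(N-\nu)}u)\big)(t)$, $t\in\mathbb{N}_{a+N}$. These values at $t$ depend only on $u(a+1),\dots,u(t)$, so they make sense for $u$ defined on $\mathbb{N}_{a+1}^b$ and $t\le b$. *)

theory Defs
  imports "HOL-Analysis.Analysis"
begin

(* Functions on a grid are total functions real => real; only their values at
   the grid points are ever used. *)

definition nabla_grid :: "real \<Rightarrow> real \<Rightarrow> real set" where
  "nabla_grid a b = {a + real k | k. a + real k \<le> b}"

(* Meaningful for t = 0, and when neither t nor t + r is a nonpositive integer. *)
definition rising_real :: "real \<Rightarrow> real \<Rightarrow> real" where
  "rising_real t r = (if t = 0 then 0 else Gamma (t + r) / Gamma t)"

definition nabla :: "(real \<Rightarrow> real) \<Rightarrow> real \<Rightarrow> real" where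
  "nabla u t = u t - u (t - 1)"

(* The sum of order \<nu> \<ge> 0, i.e. the operator with exponent -\<nu>. *)
definition nabla_frac_sum :: "real \<Rightarrow> real \<Rightarrow> (real \<Rightarrow> real) \<Rightarrow> real \<Rightarrow> real" where
  "nabla_frac_sum a \<nu> u t =
     (if \<nu> = 0 then u t
      else 1 / Gamma \<nu> * (\<Sum>s\<in>nabla_grid (a + 1) t. rising_real (t - s + 1) (\<nu> - 1) * u s))"

(* For \<nu> > 0, the N with N - 1 < \<nu> \<le> N is the ceiling of \<nu>.  Meaningful for t in
   {a + N, a + N + 1, ...}. *)
definition nabla_frac_diff :: "real \<Rightarrow> real \<Rightarrow> (real \<Rightarrow> real) \<Rightarrow> real \<Rightarrow> real" where
  "nabla_frac_diff a \<nu> u =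
     (let N = nat \<lceil>\<nu>\<rceil> in (nabla ^^ N) (nabla_frac_sum a (real N - \<nu>) u))"

end

theory Submission
  imports Defs
begin

text \<open>
  The leading coefficient of a nabla fractional difference is 1, so the difference of \<open>u\<close> at the
  first point where \<open>u\<close> does not vanish is the value of \<open>u\<close> there. The initial condition therefore
  says \<open>u (a + 1) = 0\<close>, and at the first point \<open>t\<close> with \<open>u t \<noteq> 0\<close>, which is at least \<open>a + 2\<close>, the
  equation reads \<open>u t + q t * u t = 0\<close>. Hence \<open>q t = - 1\<close>, so the sum is at least 1, which exceeds
  the claimed bound.
\<close>

lemma finite_nabla_grid: "finite (nabla_grid a b)"
proof -
  have "nabla_grid a b \<subseteq> (\<lambda>k. a + real k) ` {..nat \<lceil>b - a\<rceil>}"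
  proof
    fix x assume "x \<in> nabla_grid a b"
    then obtain k where k: "x = a + real k" "a + real k \<le> b"
      by (auto simp: nabla_grid_def)
    then have "k \<le> nat \<lceil>b - a\<rceil>" by linarith
    with k show "x \<in> (\<lambda>k. a + real k) ` {..nat \<lceil>b - a\<rceil>}" by blast
  qed
  then show ?thesis by (rule finite_subset) simp
qed

text \<open>Grid points are spaced by 1 and \<open>t\<close> is one of them, so none lies strictly
  between \<open>t - 1\<close> and \<open>t\<close>. This splits the last term off a fractional
  sum.\<close>

lemma nabla_grid_insert:
  assumes "t \<in> nabla_grid a b"
  shows "nabla_grid a t = insert t (nabla_grid a (t - 1))"
proof -
  obtain n where t: "t = a + real n"
    using assms by (auto simp: nabla_grid_def)
  have "real k \<le> real n \<longleftrightarrow> k = n \<or> real k \<le> real n - 1" for k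
    by linarith
  then show ?thesis
    unfolding nabla_grid_def t by auto
qed

lemma nabla_frac_sum_eq_0:
  assumes "\<nu> \<noteq> 0" and "\<And>s. s \<in> nabla_grid (a + 1) t \<Longrightarrow> u s = 0"
  shows "nabla_frac_sum a \<nu> u t = 0"
  using assms by (simp add: nabla_frac_sum_def)

text \<open>Only the term \<open>s = t\<close> survives, and its weight is
  \<open>rising_real 1 (\<nu> - 1) / Gamma \<nu>\<close> = 1, because
  \<open>Gamma 1 = 1\<close>.\<close>

lemma nabla_frac_sum_first:
  assumes "\<nu> > 0" and t: "t \<in> nabla_grid (a + 1) b"
    and u: "\<And>s. s \<in> nabla_grid (a + 1) (t - 1) \<Longrightarrow> u s = 0"
  shows "nabla_frac_sum a \<nu> u t = u t"
proof -
  have "t \<notin> nabla_grid (a + 1) (t - 1)"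
    by (auto simp: nabla_grid_def)
  moreover have "Gamma \<nu> \<noteq> 0"
    using Gamma_real_pos[OF \<open>\<nu> > 0\<close>] by simp
  ultimately show ?thesis
    using assms(1) u
    by (simp add: nabla_frac_sum_def nabla_grid_insert[OF t] finite_nabla_grid rising_real_def)
qed

lemma nabla_funpow_first:
  assumes "\<And>k. k > 0 \<Longrightarrow> f (t - real k) = 0"
  shows "(nabla ^^ N) f t = f t"
proof -
  have "(nabla ^^ N) f (t - real k) = (if k = 0 then f t else 0)" for k
  proof (induction N arbitrary: k)
    case 0
    then show ?case using assms by simp
  next
    case (Suc N)
    show ?case
      using Suc.IH[of k] Suc.IH[of "Suc k"] by (simp add: nabla_def algebra_simps)
  qed
  from this[of 0] show ?thesis by simp
qed

lemma nabla_frac_diff_first: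
  assumes "\<nu> > 0" and "\<nu> \<notin> \<int>" and t: "t \<in> nabla_grid (a + 1) b"
    and u: "\<And>s. s \<in> nabla_grid (a + 1) (t - 1) \<Longrightarrow> u s = 0"
  shows "nabla_frac_diff a \<nu> u t = u t"
proof -
  define \<mu> where "\<mu> = real (nat \<lceil>\<nu>\<rceil>) - \<nu>"
  have "\<mu> \<ge> 0" using \<open>\<nu> > 0\<close> unfolding \<mu>_def by linarith
  moreover have "\<mu> \<noteq> 0"
    using \<open>\<nu> \<notin> \<int>\<close> unfolding \<mu>_def by (metis Ints_of_nat eq_iff_diff_eq_0)
  ultimately have \<mu>: "\<mu> > 0" by simp
  \<comment> \<open>The iterated difference may reach points below \<open>a + 1\<close>, where
    \<open>u\<close> is arbitrary. There the sum is empty, hence 0, because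
    \<open>\<mu> \<noteq> 0\<close> excludes the case in which it is \<open>u\<close>
    itself.\<close>
  have "nabla_frac_sum a \<mu> u (t - real k) = 0" if "k > 0" for k
  proof (rule nabla_frac_sum_eq_0)
    show "\<mu> \<noteq> 0" by fact
  next
    fix s assume "s \<in> nabla_grid (a + 1) (t - real k)"
    with \<open>k > 0\<close> have "s \<in> nabla_grid (a + 1) (t - 1)"
      by (force simp: nabla_grid_def)
    then show "u s = 0" by (rule u)
  qed
  then have "nabla_frac_diff a \<nu> u t = nabla_frac_sum a \<mu> u t"
    by (simp add: nabla_frac_diff_def Let_def \<mu>_def nabla_funpow_first)
  also have "\<dots> = u t"
    using \<mu> t u by (rule nabla_frac_sum_first)
  finally show ?thesis .
qed

theorem theorem3p5:
  fixes \<alpha> a b :: real and q :: "real \<Rightarrow> real"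
  assumes "1 < \<alpha>" and "\<alpha> < 2"
    and "b - a \<in> \<int>" and "b - a \<ge> 2"
    and "\<exists>u :: real \<Rightarrow> real.
           (\<forall>t \<in> nabla_grid (a + 2) b. nabla_frac_diff a \<alpha> u t + q t * u t = 0) \<and>
           nabla_frac_diff a (\<alpha> - 1) u (a + 1) = 0 \<and>
           u b = 0 \<and>
           (\<exists>t \<in> nabla_grid (a + 1) b. u t \<noteq> 0)"
  shows "(\<Sum>s \<in> nabla_grid (a + 2) b. \<bar>q s\<bar>) \<ge> (\<alpha> - 1) / (b - a - 1)"
proof -
  obtain u where eq: "\<And>t. t \<in> nabla_grid (a + 2) b \<Longrightarrow> nabla_frac_diff a \<alpha> u t + q t * u t = 0"
    and init: "nabla_frac_diff a (\<alpha> - 1) u (a + 1) = 0"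
    and nz: "\<exists>t \<in> nabla_grid (a + 1) b. u t \<noteq> 0"
    using assms(5) by blast
  have nonint: "\<alpha> \<notin> \<int>" "\<alpha> - 1 \<notin> \<int>"
    using assms(1,2) by (auto elim!: Ints_cases)
  have "a + 1 \<in> nabla_grid (a + 1) b"
    using assms(4) by (auto simp: nabla_grid_def intro: exI[of _ 0])
  \<comment> \<open>No grid point precedes \<open>a + 1\<close>, so the vanishing condition on
    \<open>u\<close> is vacuous.\<close>
  then have "nabla_frac_diff a (\<alpha> - 1) u (a + 1) = u (a + 1)"
    using assms(1) nonint by (intro nabla_frac_diff_first) (auto simp: nabla_grid_def)
  with init have u1: "u (a + 1) = 0" by simp
  let ?P = "\<lambda>k. a + 1 + real k \<le> b \<and> u (a + 1 + real k) \<noteq> 0"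
  define m where "m = (LEAST k. ?P k)"
  define t where "t = a + 1 + real m"
  have "\<exists>k. ?P k" using nz by (auto simp: nabla_grid_def)
  then have m: "?P m" unfolding m_def by (rule LeastI_ex)
  have below: "u s = 0" if "s \<in> nabla_grid (a + 1) (t - 1)" for s
  proof -
    obtain k where k: "s = a + 1 + real k" "real k \<le> real m - 1"
      using \<open>s \<in> nabla_grid (a + 1) (t - 1)\<close> by (auto simp: nabla_grid_def t_def)
    then have "k < m" by linarith
    then have "\<not> ?P k" unfolding m_def by (rule not_less_Least)
    with k m show ?thesis by auto
  qed
  \<comment> \<open>This puts \<open>t\<close> at \<open>a + 2\<close> or later, where the equation
    is available.\<close>
  have "m \<noteq> 0" using u1 m by (cases "m = 0") auto
  then obtain j where "m = Suc j" by (cases m) auto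
  then have t: "t \<in> nabla_grid (a + 2) b"
    using m by (auto simp: nabla_grid_def t_def intro!: exI[of _ j])
  have t': "t \<in> nabla_grid (a + 1) b"
    using m by (auto simp: nabla_grid_def t_def)
  have "nabla_frac_diff a \<alpha> u t = u t"
    using assms(1) nonint(1) t' below by (intro nabla_frac_diff_first) auto
  with eq[OF t] have "(1 + q t) * u t = 0" by (simp add: algebra_simps)
  with m have "q t = - 1" by (auto simp: t_def)
  \<comment> \<open>The numerator is below 1 and the denominator is at least 1.\<close>
  have "(\<alpha> - 1) / (b - a - 1) \<le> 1"
    using assms(2,4) by simp
  also have "1 = \<bar>q t\<bar>" using \<open>q t = - 1\<close> by simp
  also have "\<dots> \<le> (\<Sum>s \<in> nabla_grid (a + 2) b. \<bar>q s\<bar>)"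
    using t by (intro member_le_sum) (auto simp: finite_nabla_grid)
  finally show ?thesis .
qed

end
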